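(* Let $\mathbb{K}\in\{\mathbb{R},\mathbb{C}\}$, let $d\ge 2$, and let $n_1 \le \dots \le n_d$ be positive integers. Then \[ \operatorname{App}_d(\mathbb{K}; n_1, \dots,n_d) = \frac{1}{\sqrt{\prod_{\mu =1}^{d-1} n_\mu}} \] if and only if orthogonal (if $\mathbb{K}=\mathbb{R}$), resp. unitary (if $\mathbb{K}=\mathbb{C}$), tensors exist in $\mathbb{K}^{n_1 \times \dots \times n_d}$. Otherwise, the value of $\operatorname{App}_d(\mathbb{K}; n_1, \dots,n_d)$ is strictly larger than $1/\sqrt{\prod_{\mu=1}^{d-1}n_\mu}$. Analogously, \[ \max_{0\ne\mathbf{X}\in\mathbb{K}^{n_1 \times \dots \times n_d}} \frac{ \| \mathbf{X} \|_*}{ \| \mathbf{X} \|_F} = \sqrt{\prod_{\mu =1}^{d-1} n_\mu} \] if and only if orthogonal (resp. unitary) tensors exist in $\mathbb{K}^{n_1 \times \dots \times n_d}$.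
   Context: $\mathbb{K}^{n_1\times\dots\times n_d}$ is the space of $d$-way arrays (tensors) $[\mathbf{X}(i_1,\dots,i_d)]$ with entries in $\mathbb{K}$. The Frobenius inner product is $\langle \mathbf{X},\mathbf{Y}\rangle_F=\sum_{i_1,\dots,i_d}\overline{\mathbf{X}(i_1,\dots,i_d)}\,\mathbf{Y}(i_1,\dots,i_d)$, with induced norm $\|\cdot\|_F$. An elementary tensor is one of the form $u^1\otimes\dots\otimes u^d$ with $u^\mu\in\mathbb{K}^{n_\mu}$, having entries $u^1(i_1)\cdots u^d(i_d)$; $\mathcal{C}_1$ denotes the set of elementary tensors. The spectral norm is $\|\mathbf{X}\|_2=\max\{|\langle \mathbf{X},u^1\otimes\dots\otimes u^d\rangle_F| : u^\mu\in\mathbb{K}^{n_\mu},\ \|u^\mu\|=1 \text{ (Euclidean norm)}\}$. The nuclear norm is $\|\mathbf{X}\|_*=\inf\{\sum_k\|\mathbf{Z}_k\|_F : \mathbf{X}=\sum_k\mathbf{Z}_k \text{ (finite sum)},\ \mathbf{Z}_k\in\mathcal{C}_1\}$. The best rank-one approximation ratio is \[\operatorname{App}_d(\mathbb{K};n_1,\dots,n_d)=\min_{0\ne\mathbf{X}\in\mathbb{K}^{n_1\times\dots\times n_d}}\frac{\|\mathbf{X}\|_2}{\|\mathbf{X}\|_F}.\] For $u\in\mathbb{K}^{n_1}$, the mode-1 contraction $\mathbf{X}\times_1 u\in\mathbb{K}^{n_2\times\dots\times n_d}$ has entries $\sum_{i=1}^{n_1}u(i)\,\mathbf{X}(i,i_2,\dots,i_d)$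 (no complex conjugation). Orthogonal (for $\mathbb{K}=\mathbb{R}$) and unitary (for $\mathbb{K}=\mathbb{C}$) tensors are defined recursively: a tensor of order one, i.e. a vector, is orthogonal (resp. unitary) if its Euclidean norm equals one; for $n_1\le\dots\le n_d$, a tensor $\mathbf{X}\in\mathbb{K}^{n_1\times\dots\times n_d}$ of order $d\ge2$ is orthogonal (resp. unitary) if for every unit vector $u\in\mathbb{K}^{n_1}$ the order-$(d-1)$ tensor $\mathbf{X}\times_1u$ is orthogonal (resp. unitary). *)

theory Defs
  imports "HOL-Analysis.Analysis"
begin

text \<open>
  The scalars are \<^typ>\<open>real\<close> or \<^typ>\<open>complex\<close>. The class below only serves to write the definitions
  once for both: conjugation is the identity on \<^typ>\<open>real\<close> and \<^const>\<open>cnj\<close> on \<^typ>\<open>complex\<close>.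
\<close>

class conj_field = real_normed_field +
  fixes conjg :: "'a \<Rightarrow> 'a"
  assumes conjg_add: "conjg (x + y) = conjg x + conjg y"
    and conjg_mult: "conjg (x * y) = conjg x * conjg y"
    and conjg_mult_self: "conjg x * x = (norm x)\<^sup>2 *\<^sub>R 1"

instantiation real :: conj_field
begin

definition conjg_real :: "real \<Rightarrow> real"
  where "conjg_real x = x"

instance
  by standard (auto simp: conjg_real_def power2_eq_square)

end

instantiation complex :: conj_field
begin

definition conjg_complex :: "complex \<Rightarrow> complex"
  where "conjg_complex z = cnj z"

instance
  by standard (auto simp: conjg_complex_def scaleR_conv_of_real complex_norm_square mult.commute simp del: of_real_power)

end

text \<open>
  The format \<open>n\<^sub>1 \<times> \<dots> \<times> n\<^sub>d\<close> is the list \<open>ns = [n\<^sub>1, \<dots>, n\<^sub>d]\<close> and a multi-index is a list of length \<open>d\<close>;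
  all indices start at \<open>0\<close>. A tensor is a function on multi-indices that vanishes outside its format,
  so that equality of tensors is equality of functions. A vector of length \<open>n\<close> is a function
  on \<^typ>\<open>nat\<close> of which only the values on \<open>{..<n}\<close> are ever used.
\<close>

definition indices :: "nat list \<Rightarrow> nat list set"
  where "indices ns = {is. list_all2 (<) is ns}"

definition tensors :: "nat list \<Rightarrow> (nat list \<Rightarrow> 'k::conj_field) set"
  where "tensors ns = {X. \<forall>is. is \<notin> indices ns \<longrightarrow> X is = 0}"

definition vec_norm :: "nat \<Rightarrow> (nat \<Rightarrow> 'k::conj_field) \<Rightarrow> real"
  where "vec_norm n u = L2_set (\<lambda>i. norm (u i)) {..<n}"

definition frob_inner ::
    "nat list \<Rightarrow> (nat list \<Rightarrow> 'k::conj_field) \<Rightarrow> (nat list \<Rightarrow> 'k) \<Rightarrow> 'k"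
  where "frob_inner ns X Y = (\<Sum>is\<in>indices ns. conjg (X is) * Y is)"

definition frob_norm :: "nat list \<Rightarrow> (nat list \<Rightarrow> 'k::conj_field) \<Rightarrow> real"
  where "frob_norm ns X = L2_set (\<lambda>is. norm (X is)) (indices ns)"

lemma frob_inner_self:
  "frob_inner ns X X = of_real ((frob_norm ns X)\<^sup>2)"
  by (simp add: frob_inner_def frob_norm_def L2_set_def conjg_mult_self scaleR_conv_of_real sum_nonneg)

text \<open>\<open>elem_tensor ns u\<close> is \<open>u 0 \<otimes> \<dots> \<otimes> u (d - 1)\<close>.\<close>

definition elem_tensor :: "nat list \<Rightarrow> (nat \<Rightarrow> nat \<Rightarrow> 'k::conj_field) \<Rightarrow> nat list \<Rightarrow> 'k"
  where "elem_tensor ns u = (\<lambda>is. if is \<in> indices ns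
    then (\<Prod>\<mu><length ns. u \<mu> (is ! \<mu>)) else 0)"

definition elem_tensors :: "nat list \<Rightarrow> (nat list \<Rightarrow> 'k::conj_field) set"
  where "elem_tensors ns = range (elem_tensor ns)"

text \<open>
  On \<^typ>\<open>real\<close>, \<open>LEAST\<close> and \<open>GREATEST\<close> denote an attained minimum and maximum, as opposed
  to \<^const>\<open>Inf\<close> and \<^const>\<open>Sup\<close>.
\<close>

definition spectral_norm :: "nat list \<Rightarrow> (nat list \<Rightarrow> 'k::conj_field) \<Rightarrow> real"
  where "spectral_norm ns X = (GREATEST r. \<exists>u.
    (\<forall>\<mu><length ns. vec_norm (ns ! \<mu>) (u \<mu>) = 1) \<and>
    r = norm (frob_inner ns X (elem_tensor ns u)))"

definition nuclear_norm :: "nat list \<Rightarrow> (nat list \<Rightarrow> 'k::conj_field) \<Rightarrow> real"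
  where "nuclear_norm ns X = Inf {(\<Sum>k<m. frob_norm ns (Z k)) | (m::nat) Z.
    (\<forall>k<m. Z k \<in> elem_tensors ns) \<and> X = (\<lambda>is. \<Sum>k<m. Z k is)}"

definition App :: "'k::conj_field itself \<Rightarrow> nat list \<Rightarrow> real"
  where "App K ns = (LEAST r. \<exists>X :: nat list \<Rightarrow> 'k. X \<in> tensors ns \<and> X \<noteq> (\<lambda>_. 0) \<and>
    r = spectral_norm ns X / frob_norm ns X)"

definition max_nuclear_ratio :: "'k::conj_field itself \<Rightarrow> nat list \<Rightarrow> real"
  where "max_nuclear_ratio K ns = (GREATEST r. \<exists>X :: nat list \<Rightarrow> 'k. X \<in> tensors ns \<and>
    X \<noteq> (\<lambda>_. 0) \<and> r = nuclear_norm ns X / frob_norm ns X)"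

definition contract1 :: "nat \<Rightarrow> (nat list \<Rightarrow> 'k::conj_field) \<Rightarrow> (nat \<Rightarrow> 'k) \<Rightarrow> nat list \<Rightarrow> 'k"
  where "contract1 n X u = (\<lambda>is. \<Sum>i<n. u i * X (i # is))"

text \<open>
  Orthogonal tensors for \<^typ>\<open>real\<close>, unitary tensors for \<^typ>\<open>complex\<close>, for \<^const>\<open>sorted\<close> formats of
  order at least one. The clause for order zero is a dummy.
\<close>

fun unitary_tensor :: "nat list \<Rightarrow> (nat list \<Rightarrow> 'k::conj_field) \<Rightarrow> bool" where
  "unitary_tensor [] X \<longleftrightarrow> False"
| "unitary_tensor [n] X \<longleftrightarrow> frob_norm [n] X = 1"
| "unitary_tensor (n # m # ns) X \<longleftrightarrow>
     (\<forall>u. vec_norm n u = 1 \<longrightarrow> unitary_tensor (m # ns) (contract1 n X u))"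

abbreviation orthogonal_tensor :: "nat list \<Rightarrow> (nat list \<Rightarrow> real) \<Rightarrow> bool"
  where "orthogonal_tensor \<equiv> unitary_tensor"

end

theory Submission imports Defs begin

text \<open>
  Let \<open>M\<close> be the square root of the product of all dimensions but the last. Splitting a tensor into its slices
  along the first direction gives, by recursion, the two universal bounds \<open>\<parallel>X\<parallel>\<^sub>F \<le> M \<parallel>X\<parallel>\<^sub>2\<close>
  (\<open>frob_norm_sq_le_spectral_le\<close>) and \<open>\<parallel>X\<parallel>\<^sub>* \<le> M \<parallel>X\<parallel>\<^sub>F\<close> (\<open>nuclear_norm_le_frob_norm\<close>). So the spectral ratio is
  at least \<open>1 / M\<close>, the nuclear ratio is at most \<open>M\<close>, and what has to be found is when equality occurs.

  Equality in the first bound characterises unitary tensors up to scaling. A unitary tensor has \<open>\<parallel>X\<parallel>\<^sub>2 \<le> 1\<close> and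
  \<open>\<parallel>X\<parallel>\<^sub>F = M\<close> by recursion. Conversely, if \<open>\<parallel>X\<parallel>\<^sub>2 \<le> 1\<close> and \<open>\<parallel>X\<parallel>\<^sub>F \<ge> M\<close>, then the contraction with \<open>u\<close> has spectral norm
  at most \<open>\<parallel>u\<parallel>\<close>, so the bound for the smaller format applies to it, and the quadratic form \<open>p \<parallel>u\<parallel>\<^sup>2 - \<parallel>X \<times>\<^sub>1 u\<parallel>\<^sub>F\<^sup>2\<close>
  is nonnegative, where \<open>p\<close> is \<open>M\<^sup>2\<close> for the smaller format. Its trace is not positive, so it is zero
  (\<open>contract1_frob_norm_extremal\<close>): every contraction with a unit vector is again extremal, and thus unitary by
  recursion (\<open>unitary_tensor_if_extremal\<close>).

  For the nuclear norm, \<open>\<langle>U, U\<rangle> \<le> \<parallel>U\<parallel>\<^sub>*\<close> shows that a unitary tensor \<open>U\<close> attains the second bound. If some tensor attains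
  it, then removing from it a small multiple of an elementary tensor and comparing the terms of first order
  shows that the same tensor attains the first bound (\<open>spectral_le_if_nuclear_norm_extremal\<close>), so that a multiple
  of it is unitary.

  Finally the minimum and the maximum in the definitions of the two ratios are attained, since both norms
  are continuous on the compact unit sphere of the Frobenius norm. Hence an extremal value of a ratio comes
  with an extremal tensor. The argument runs over an arbitrary scalar class with a conjugation and compact
  balls, of which the real and the complex numbers are instances.
\<close>

section \<open>Conjugation\<close>

lemma conjg_0 [simp]: "conjg (0::'k::conj_field) = 0"
  using conjg_add [of "0::'k" 0] by simp

lemma conjg_minus: "conjg (- x) = - conjg (x::'k::conj_field)"
  using conjg_add [of x "- x"] by (simp add: eq_neg_iff_add_eq_0 add.commute)

lemma conjg_diff: "conjg (x - y) = conjg x - conjg (y::'k::conj_field)"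
  using conjg_add [of x "- y"] by (simp add: conjg_minus)

lemma conjg_sum: "conjg (sum f A) = (\<Sum>a\<in>A. conjg (f a :: 'k::conj_field))"
  by (induction A rule: infinite_finite_induct) (auto simp: conjg_add)

lemma conjg_eq_divide: "conjg x = of_real ((norm x)\<^sup>2) / (x::'k::conj_field)"
  using conjg_mult_self [of x] by (cases "x = 0") (auto simp: field_simps scaleR_conv_of_real)

lemma norm_conjg [simp]: "norm (conjg x) = norm (x::'k::conj_field)"
  by (cases "x = 0") (auto simp: conjg_eq_divide norm_divide norm_mult power2_eq_square)

lemma conjg_conjg [simp]: "conjg (conjg x) = (x::'k::conj_field)"
proof (cases "x = 0")
  case False
  have "conjg (conjg x) * conjg x = x * conjg x"
    using conjg_mult_self [of x] conjg_mult_self [of "conjg x"] by (simp add: mult.commute)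
  moreover have "conjg x \<noteq> 0"
    using False norm_conjg [of x] by (metis norm_eq_zero)
  ultimately show ?thesis by simp
qed simp

lemma conjg_of_real [simp]: "conjg (of_real r) = (of_real r :: 'k::conj_field)"
  by (cases "r = 0") (auto simp: conjg_eq_divide power2_eq_square)

lemma parallelogram_law_norm:
  "(norm (x + y))\<^sup>2 + (norm (x - y))\<^sup>2 = 2 * (norm x)\<^sup>2 + 2 * (norm (y::'k::conj_field))\<^sup>2"
proof -
  have sq: "of_real ((norm z)\<^sup>2) = conjg z * z" for z :: 'k
    by (simp add: conjg_mult_self scaleR_conv_of_real)
  have "of_real ((norm (x + y))\<^sup>2 + (norm (x - y))\<^sup>2)
      = (of_real (2 * (norm x)\<^sup>2 + 2 * (norm y)\<^sup>2) :: 'k)"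
    unfolding of_real_add of_real_mult sq
    by (simp add: conjg_add conjg_diff algebra_simps)
  then show ?thesis
    unfolding of_real_eq_iff .
qed

section \<open>Tensors, inner products and elementary tensors\<close>

lemma indices_Nil [simp]: "indices [] = {[]}"
  by (auto simp: indices_def)

lemma Cons_mem_indices [simp]: "i # is \<in> indices (n # ns) \<longleftrightarrow> i < n \<and> is \<in> indices ns"
  by (auto simp: indices_def)

lemma indices_Cons: "indices (n # ns) = (\<lambda>(i, is). i # is) ` ({..<n} \<times> indices ns)"
  by (auto simp: indices_def list_all2_Cons2 image_iff)

lemma finite_indices [simp]: "finite (indices ns)"
  by (induction ns) (auto simp: indices_Cons)

lemma sum_indices_Cons: "sum f (indices (n # ns)) = (\<Sum>i<n. \<Sum>is\<in>indices ns. f (i # is))"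
proof -
  have "inj_on (\<lambda>(i, is). i # is) ({..<n} \<times> indices ns)"
    by (auto simp: inj_on_def)
  then show ?thesis
    by (simp add: indices_Cons sum.reindex sum.cartesian_product case_prod_unfold)
qed

lemma indices_nonempty: "0 \<notin> set ns \<Longrightarrow> indices ns \<noteq> {}"
  by (induction ns) (auto simp: indices_Cons)

lemma frob_norm_nonneg [simp]: "0 \<le> frob_norm ns X"
  by (simp add: frob_norm_def L2_set_nonneg)

lemma vec_norm_nonneg [simp]: "0 \<le> vec_norm n u"
  by (simp add: vec_norm_def L2_set_nonneg)

lemma frob_norm_sq: "(frob_norm ns X)\<^sup>2 = (\<Sum>is\<in>indices ns. (norm (X is))\<^sup>2)"
  by (simp add: frob_norm_def L2_set_def sum_nonneg)

lemma vec_norm_sq: "(vec_norm n u)\<^sup>2 = (\<Sum>i<n. (norm (u i))\<^sup>2)"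
  by (simp add: vec_norm_def L2_set_def sum_nonneg)

lemma frob_norm_sq_Cons:
  "(frob_norm (n # ns) X)\<^sup>2 = (\<Sum>i<n. (frob_norm ns (\<lambda>is. X (i # is)))\<^sup>2)"
  by (simp add: frob_norm_sq sum_indices_Cons)

lemma frob_norm_single: "frob_norm [n] X = vec_norm n (\<lambda>i. X [i])"
proof -
  have "(frob_norm [n] X)\<^sup>2 = (vec_norm n (\<lambda>i. X [i]))\<^sup>2"
    by (simp add: frob_norm_sq_Cons vec_norm_sq) (simp add: frob_norm_sq)
  then show ?thesis by simp
qed

lemma vec_norm_cong: "(\<And>i. i < n \<Longrightarrow> u i = v i) \<Longrightarrow> vec_norm n u = vec_norm n v"
  by (auto simp: vec_norm_def intro!: L2_set_cong)

lemma frob_norm_cmult: "frob_norm ns (\<lambda>is. c * X is) = norm c * frob_norm ns X"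
  by (simp add: frob_norm_def norm_mult L2_set_right_distrib)

lemma vec_norm_cmult: "vec_norm n (\<lambda>i. c * u i) = norm c * vec_norm n u"
  by (simp add: vec_norm_def norm_mult L2_set_right_distrib)

lemma frob_norm_eq_0_iff: "frob_norm ns X = 0 \<longleftrightarrow> (\<forall>is\<in>indices ns. X is = 0)"
  by (simp add: frob_norm_def L2_set_eq_0_iff)

lemma frob_norm_pos:
  assumes "X \<in> tensors ns" "X \<noteq> (\<lambda>_. 0)" shows "0 < frob_norm ns X"
proof -
  have "frob_norm ns X \<noteq> 0"
    using assms by (fastforce simp: frob_norm_eq_0_iff tensors_def fun_eq_iff)
  then show ?thesis
    by (simp add: order_less_le)
qed

lemma parallelogram_law_frob_norm:
  "(frob_norm ns (\<lambda>is. X is + Y is))\<^sup>2 + (frob_norm ns (\<lambda>is. X is - Y is))\<^sup>2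
    = 2 * (frob_norm ns X)\<^sup>2 + 2 * (frob_norm ns Y)\<^sup>2"
  by (simp add: frob_norm_sq parallelogram_law_norm sum_distrib_left flip: sum.distrib)

lemma parallelogram_law_vec_norm:
  "(vec_norm n (\<lambda>i. u i + v i))\<^sup>2 + (vec_norm n (\<lambda>i. u i - v i))\<^sup>2
    = 2 * (vec_norm n u)\<^sup>2 + 2 * (vec_norm n v)\<^sup>2"
  by (simp add: vec_norm_sq parallelogram_law_norm sum_distrib_left flip: sum.distrib)

lemma norm_frob_inner_le: "norm (frob_inner ns X Y) \<le> frob_norm ns X * frob_norm ns Y"
proof -
  have "norm (frob_inner ns X Y) \<le> (\<Sum>is\<in>indices ns. \<bar>norm (X is)\<bar> * \<bar>norm (Y is)\<bar>)"
    unfolding frob_inner_def by (rule order_trans [OF norm_sum]) (simp add: norm_mult)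
  also have "\<dots> \<le> frob_norm ns X * frob_norm ns Y"
    unfolding frob_norm_def by (rule L2_set_mult_ineq)
  finally show ?thesis .
qed

lemma frob_inner_cmult_right: "frob_inner ns X (\<lambda>is. c * Y is) = c * frob_inner ns X Y"
  by (simp add: frob_inner_def sum_distrib_left mult.left_commute)

lemma frob_inner_cmult_left: "frob_inner ns (\<lambda>is. c * X is) Y = conjg c * frob_inner ns X Y"
  by (simp add: frob_inner_def sum_distrib_left conjg_mult mult.assoc)

lemma frob_inner_diff_left:
  "frob_inner ns (\<lambda>is. X is - Y is) Z = frob_inner ns X Z - frob_inner ns Y Z"
  by (simp add: frob_inner_def conjg_diff algebra_simps sum_subtractf)

lemma frob_inner_sum_right:
  "frob_inner ns X (\<lambda>is. \<Sum>k\<in>K. Z k is) = (\<Sum>k\<in>K. frob_inner ns X (Z k))"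
  by (simp add: frob_inner_def sum_distrib_left) (rule sum.swap)

lemma conjg_frob_inner: "conjg (frob_inner ns X Y) = frob_inner ns Y X"
  by (simp add: frob_inner_def conjg_sum conjg_mult mult.commute)

text \<open>
  The cross terms of \<open>\<langle>X - Y, X - Y\<rangle>\<close> are conjugates of each other. A real \<open>\<langle>X, Y\<rangle>\<close> makes them equal, which
  spares a real part, an operation that the common scalar class does not offer.
\<close>

lemma frob_norm_diff_sq:
  assumes "frob_inner ns X Y = of_real r"
  shows "(frob_norm ns (\<lambda>is. X is - Y is))\<^sup>2 = (frob_norm ns X)\<^sup>2 - 2 * r + (frob_norm ns Y)\<^sup>2"
proof -
  have "of_real ((frob_norm ns (\<lambda>is. X is - Y is))\<^sup>2)
      = frob_inner ns X X - frob_inner ns X Y - frob_inner ns Y X + frob_inner ns Y Y"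
    unfolding frob_inner_self [symmetric]
    by (simp add: frob_inner_def conjg_diff algebra_simps sum_subtractf sum.distrib)
  also have "frob_inner ns Y X = of_real r"
    using assms conjg_frob_inner [of ns X Y] by simp
  also have "frob_inner ns X X - frob_inner ns X Y - of_real r + frob_inner ns Y Y
      = of_real ((frob_norm ns X)\<^sup>2 - 2 * r + (frob_norm ns Y)\<^sup>2)"
    by (simp add: assms frob_inner_self)
  finally show ?thesis
    by (simp only: of_real_eq_iff)
qed

lemma elem_tensor_Cons:
  "elem_tensor (n # ns) u (i # is) = (if i < n then u 0 i else 0) * elem_tensor ns (\<lambda>\<mu>. u (Suc \<mu>)) is"
  by (auto simp: elem_tensor_def prod.lessThan_Suc_shift simp del: prod.lessThan_Suc)

lemma elem_tensor_in_tensors: "elem_tensor ns u \<in> tensors ns"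
  by (simp add: tensors_def elem_tensor_def)

lemma frob_norm_elem_tensor:
  "frob_norm ns (elem_tensor ns u) = (\<Prod>\<mu><length ns. vec_norm (ns ! \<mu>) (u \<mu>))"
proof (induction ns arbitrary: u)
  case Nil
  then show ?case by (simp add: frob_norm_def elem_tensor_def)
next
  case (Cons n ns)
  have "(frob_norm (n # ns) (elem_tensor (n # ns) u))\<^sup>2
      = (vec_norm n (u 0) * frob_norm ns (elem_tensor ns (\<lambda>\<mu>. u (Suc \<mu>))))\<^sup>2"
    by (simp add: frob_norm_sq_Cons elem_tensor_Cons frob_norm_cmult power_mult_distrib
        vec_norm_sq sum_distrib_right)
  then have "frob_norm (n # ns) (elem_tensor (n # ns) u)
      = vec_norm n (u 0) * frob_norm ns (elem_tensor ns (\<lambda>\<mu>. u (Suc \<mu>)))"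
    by simp
  then show ?case
    by (simp add: Cons.IH prod.lessThan_Suc_shift del: prod.lessThan_Suc)
qed

lemma elem_tensor_scale:
  "elem_tensor ns (\<lambda>\<mu> i. c \<mu> * u \<mu> i) = (\<lambda>is. (\<Prod>\<mu><length ns. c \<mu>) * elem_tensor ns u is)"
  by (auto simp: elem_tensor_def prod.distrib)

lemma cmult_elem_tensors:
  assumes "Z \<in> elem_tensors ns" "ns \<noteq> []"
  shows "(\<lambda>is. c * Z is) \<in> elem_tensors ns"
proof -
  obtain u where u: "Z = elem_tensor ns u"
    using assms by (auto simp: elem_tensors_def)
  have "(\<Prod>\<mu><length ns. if \<mu> = 0 then c else 1) = c"
    using assms(2) by (subst prod.delta) auto
  then have "(\<lambda>is. c * Z is) = elem_tensor ns (\<lambda>\<mu> i. (if \<mu> = 0 then c else 1) * u \<mu> i)"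
    unfolding elem_tensor_scale u by simp
  then show ?thesis by (auto simp: elem_tensors_def)
qed

section \<open>Bounds on the spectral norm\<close>

definition unit_vectors :: "nat list \<Rightarrow> (nat \<Rightarrow> nat \<Rightarrow> 'k::conj_field) \<Rightarrow> bool"
  where "unit_vectors ns u \<longleftrightarrow> (\<forall>\<mu><length ns. vec_norm (ns ! \<mu>) (u \<mu>) = 1)"

text \<open>
  The spectral norm of \<open>X\<close> is at most \<open>s\<close>. In this form the bound is stable under the recursion over the
  order, independently of whether the maximum over the unit vectors is attained.
\<close>

definition spectral_le :: "nat list \<Rightarrow> (nat list \<Rightarrow> 'k::conj_field) \<Rightarrow> real \<Rightarrow> bool"
  where "spectral_le ns X s \<longleftrightarrow>
    (\<forall>u. unit_vectors ns u \<longrightarrow> norm (frob_inner ns X (elem_tensor ns u)) \<le> s)"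

lemma frob_norm_elem_tensor_unit: "unit_vectors ns u \<Longrightarrow> frob_norm ns (elem_tensor ns u) = 1"
  by (simp add: frob_norm_elem_tensor unit_vectors_def)

text \<open>
  Both sides are multiplicative in each factor of \<open>Z\<close>, so normalising the factors reduces to unit vectors;
  if some factor vanishes then so does \<open>Z\<close>.
\<close>

lemma spectral_leD:
  assumes "spectral_le ns X s" and Z: "Z \<in> elem_tensors ns"
  shows "norm (frob_inner ns X Z) \<le> s * frob_norm ns Z"
proof -
  obtain u where u: "Z = elem_tensor ns u"
    using Z by (auto simp: elem_tensors_def)
  show ?thesis
  proof (cases "frob_norm ns Z = 0")
    case True
    then show ?thesis
      using norm_frob_inner_le [of ns X Z] by simp
  next
    case False
    define c where "c = (\<lambda>\<mu>. vec_norm (ns ! \<mu>) (u \<mu>))"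
    define v where "v = (\<lambda>\<mu> i. of_real (inverse (c \<mu>)) * u \<mu> i)"
    have c: "c \<mu> > 0" if "\<mu> < length ns" for \<mu>
      using False that by (auto simp: u frob_norm_elem_tensor c_def order_less_le)
    have "unit_vectors ns v"
      unfolding unit_vectors_def v_def vec_norm_cmult
      using c by (simp add: c_def norm_inverse order_less_imp_not_eq2)
    then have "norm (frob_inner ns X (elem_tensor ns v)) \<le> s"
      using assms(1) by (simp add: spectral_le_def)
    moreover have "norm (frob_inner ns X (elem_tensor ns v))
        = norm (frob_inner ns X Z) / frob_norm ns Z"
      unfolding v_def elem_tensor_scale frob_inner_cmult_right u frob_norm_elem_tensor of_real_prod [symmetric]
      by (simp add: c_def norm_mult norm_inverse divide_inverse
          prod_inversef [unfolded o_def] flip: prod_norm)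
    moreover have "frob_norm ns Z > 0"
      using False by (simp add: order_less_le)
    ultimately show ?thesis
      by (simp add: field_simps)
  qed
qed

text \<open>
  Contraction is adjoint to prepending a factor. The inner product conjugates \<open>X\<close>, whereas contraction does
  not conjugate, hence the conjugated first factor.
\<close>

lemma frob_inner_Cons_elem_tensor:
  fixes X :: "nat list \<Rightarrow> 'k::conj_field"
  shows "frob_inner (n # ns) X (elem_tensor (n # ns) (case_nat (\<lambda>i. conjg (u i)) w))
    = frob_inner ns (contract1 n X u) (elem_tensor ns w)"
proof -
  have "frob_inner (n # ns) X (elem_tensor (n # ns) (case_nat (\<lambda>i. conjg (u i)) w))
      = (\<Sum>i<n. \<Sum>is\<in>indices ns. conjg (u i * X (i # is)) * elem_tensor ns w is)"
    by (auto simp: frob_inner_def sum_indices_Cons elem_tensor_Cons conjg_mult mult_ac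
        intro!: sum.cong)
  also have "\<dots> = frob_inner ns (contract1 n X u) (elem_tensor ns w)"
    unfolding frob_inner_def contract1_def conjg_sum sum_distrib_right by (rule sum.swap)
  finally show ?thesis .
qed

lemma spectral_le_contract1:
  fixes X :: "nat list \<Rightarrow> 'k::conj_field"
  assumes "spectral_le (n # ns) X s"
  shows "spectral_le ns (contract1 n X u) (s * vec_norm n u)"
  unfolding spectral_le_def
proof (intro allI impI)
  fix w :: "nat \<Rightarrow> nat \<Rightarrow> 'k" assume w: "unit_vectors ns w"
  let ?v = "case_nat (\<lambda>i. conjg (u i)) w"
  have "frob_norm (n # ns) (elem_tensor (n # ns) ?v) = vec_norm n u"
    using w unfolding frob_norm_elem_tensor
    by (simp add: prod.lessThan_Suc_shift unit_vectors_def vec_norm_def del: prod.lessThan_Suc)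
  then show "norm (frob_inner ns (contract1 n X u) (elem_tensor ns w)) \<le> s * vec_norm n u"
    using spectral_leD [OF assms, of "elem_tensor (n # ns) ?v"]
    by (simp add: elem_tensors_def frob_inner_Cons_elem_tensor)
qed

lemma spectral_le_cmult: "spectral_le ns X s \<Longrightarrow> spectral_le ns (\<lambda>is. c * X is) (norm c * s)"
  by (auto simp: spectral_le_def frob_inner_cmult_left norm_mult intro!: mult_left_mono)

lemma contract1_delta: "i < n \<Longrightarrow> contract1 n X (\<lambda>j. if j = i then 1 else 0) = (\<lambda>is. X (i # is))"
  by (auto simp: contract1_def if_distrib [of "\<lambda>x. x * _"] sum.delta' cong: if_cong)

lemma vec_norm_delta: "i < n \<Longrightarrow> vec_norm n (\<lambda>j. if j = i then 1 else 0 :: 'k::conj_field) = 1"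
proof -
  assume "i < n"
  then have "(vec_norm n (\<lambda>j. if j = i then 1 else 0 :: 'k))\<^sup>2 = 1"
    by (simp add: vec_norm_sq if_distrib [of "\<lambda>x. (norm x)\<^sup>2"] cong: if_cong)
  then show ?thesis
    using power2_eq_1_iff [of "vec_norm n (\<lambda>j. if j = i then 1 else 0 :: 'k)"]
      vec_norm_nonneg [of n "\<lambda>j. if j = i then 1 else 0 :: 'k"] by linarith
qed

lemma spectral_le_slice:
  "spectral_le (n # ns) X s \<Longrightarrow> i < n \<Longrightarrow> spectral_le ns (\<lambda>is. X (i # is)) s"
  using spectral_le_contract1 [of n ns X s "\<lambda>j. if j = i then 1 else 0"]
  by (simp add: contract1_delta vec_norm_delta)

lemma vector_elem_tensor:
  "X \<in> tensors [n] \<Longrightarrow> X = elem_tensor [n] (\<lambda>_ i. X [i])"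
  by (auto simp: elem_tensor_def tensors_def indices_Cons fun_eq_iff)

lemma frob_norm_le_spectral_le_vector:
  assumes "spectral_le [n] X s" "0 \<le> s"
  shows "frob_norm [n] X \<le> s"
proof -
  let ?Z = "elem_tensor [n] (\<lambda>_ i. X [i])"
  have "frob_inner [n] X ?Z = frob_inner [n] X X" "frob_norm [n] ?Z = frob_norm [n] X"
    by (auto simp: frob_inner_def sum_indices_Cons elem_tensor_Cons elem_tensor_def
        frob_norm_single intro!: vec_norm_cong)
  then have "(frob_norm [n] X)\<^sup>2 \<le> s * frob_norm [n] X"
    using spectral_leD [OF assms(1), of ?Z] by (simp add: elem_tensors_def frob_inner_self norm_power)
  then show ?thesis
    using assms(2) frob_norm_nonneg [of "[n]" X]
    by (cases "frob_norm [n] X = 0") (auto simp: power2_eq_square mult_le_cancel_right order_less_le)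
qed

text \<open>
  A tensor of order one has spectral norm equal to its Frobenius norm. Each additional direction splits the
  tensor into \<open>n\<close> slices, which inherit the bound \<open>s\<close>, and \<open>\<parallel>X\<parallel>\<^sub>F\<^sup>2\<close> is the sum of the squared norms of the slices.
\<close>

lemma frob_norm_sq_le_spectral_le:
  assumes "ns \<noteq> []" "spectral_le ns X s" "0 \<le> s"
  shows "(frob_norm ns X)\<^sup>2 \<le> real (prod_list (butlast ns)) * s\<^sup>2"
  using assms
proof (induction ns arbitrary: X)
  case (Cons n ns)
  show ?case
  proof (cases "ns = []")
    case True
    then show ?thesis
      using frob_norm_le_spectral_le_vector [of n X s] Cons.prems by (simp add: power_mono)
  next
    case False
    have "(frob_norm (n # ns) X)\<^sup>2 \<le> (\<Sum>i<n. real (prod_list (butlast ns)) * s\<^sup>2)"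
      unfolding frob_norm_sq_Cons using Cons.prems False
      by (intro sum_mono Cons.IH) (auto intro: spectral_le_slice)
    then show ?thesis using False by simp
  qed
qed simp

lemma contract1_add: "contract1 n X (\<lambda>i. u i + v i) = (\<lambda>is. contract1 n X u is + contract1 n X v is)"
  by (simp add: contract1_def fun_eq_iff algebra_simps sum.distrib)

lemma contract1_diff: "contract1 n X (\<lambda>i. u i - v i) = (\<lambda>is. contract1 n X u is - contract1 n X v is)"
  by (simp add: contract1_def fun_eq_iff algebra_simps sum_subtractf)

lemma contract1_cmult: "contract1 n X (\<lambda>i. c * u i) = (\<lambda>is. c * contract1 n X u is)"
  by (simp add: contract1_def fun_eq_iff sum_distrib_left mult.assoc)

lemma contract1_cong: "(\<And>i. i < n \<Longrightarrow> u i = v i) \<Longrightarrow> contract1 n X u = contract1 n X v"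
  by (auto simp: contract1_def fun_eq_iff)

section \<open>Unitary tensors as the extremal tensors\<close>

text \<open>
  Only the entries below \<open>n\<close> of a vector matter, which the premise \<open>cong\<close> expresses; up to that, the unit
  vectors span.
\<close>

lemma vector_induct_delta:
  fixes u :: "nat \<Rightarrow> 'k::conj_field"
  assumes cong: "\<And>u v. (\<And>i. i < n \<Longrightarrow> u i = v i) \<Longrightarrow> P u \<Longrightarrow> P v"
    and zero: "P (\<lambda>_. 0)"
    and add: "\<And>u v. P u \<Longrightarrow> P v \<Longrightarrow> P (\<lambda>i. u i + v i)"
    and delta: "\<And>i c. i < n \<Longrightarrow> P (\<lambda>j. c * (if j = i then 1 else 0))"
  shows "P u"
proof -
  have "P (\<lambda>j. \<Sum>i\<in>{..<k}. u i * (if j = i then 1 else 0))" if "k \<le> n" for k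
    using that
  proof (induction k)
    case (Suc k)
    then have "P (\<lambda>j. \<Sum>i<k. u i * (if j = i then 1 else 0))"
      "P (\<lambda>j. u k * (if j = k then 1 else 0))"
      by (auto intro: delta)
    then show ?case
      unfolding sum.lessThan_Suc by (rule add)
  qed (simp add: zero)
  from this [OF order_refl] show ?thesis
    by (rule cong [rotated]) (simp add: sum.delta' if_distrib [of "\<lambda>x. _ * x"] cong: if_cong)
qed

text \<open>
  The key step. Let \<open>g u = p \<parallel>u\<parallel>\<^sup>2 - \<parallel>X \<times>\<^sub>1 u\<parallel>\<^sub>F\<^sup>2\<close>, a nonnegative quadratic form. Its values at the standard basis add up to
  \<open>n p - \<parallel>X\<parallel>\<^sub>F\<^sup>2 \<le> 0\<close>, so it vanishes there. By the parallelogram law \<open>g (u + v) + g (u - v) = 2 g u + 2 g v\<close>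
  the zeros of a nonnegative quadratic form are closed under addition, so \<open>g\<close> vanishes everywhere. This
  plays the role of completing \<open>u\<close> to an orthonormal basis.
\<close>

lemma contract1_frob_norm_extremal:
  fixes X :: "nat list \<Rightarrow> 'k::conj_field"
  assumes le: "\<And>u. (frob_norm ns (contract1 n X u))\<^sup>2 \<le> p * (vec_norm n u)\<^sup>2"
    and ge: "real n * p \<le> (frob_norm (n # ns) X)\<^sup>2"
  shows "(frob_norm ns (contract1 n X u))\<^sup>2 = p * (vec_norm n u)\<^sup>2"
proof -
  define g where "g u = p * (vec_norm n u)\<^sup>2 - (frob_norm ns (contract1 n X u))\<^sup>2" for u
  have g_nonneg: "0 \<le> g u" for u
    using le by (simp add: g_def)
  have parallelogram: "g (\<lambda>i. u i + v i) + g (\<lambda>i. u i - v i) = 2 * g u + 2 * g v" for u v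
    using arg_cong [OF parallelogram_law_vec_norm [of n u v], of "\<lambda>x. p * x"]
      parallelogram_law_frob_norm [of ns "contract1 n X u" "contract1 n X v"]
    unfolding g_def contract1_add contract1_diff by (simp add: algebra_simps)
  have scale: "g (\<lambda>i. c * u i) = (norm c)\<^sup>2 * g u" for c u
    unfolding g_def contract1_cmult frob_norm_cmult vec_norm_cmult
    by (simp add: power_mult_distrib algebra_simps)
  have "(\<Sum>i<n. g (\<lambda>j. if j = i then 1 else 0)) \<le> 0"
    using ge by (simp add: g_def vec_norm_delta contract1_delta sum_subtractf frob_norm_sq_Cons)
  then have g_delta: "g (\<lambda>j. if j = i then 1 else 0) = 0" if "i < n" for i
    using that sum_nonneg_eq_0_iff [of "{..<n}" "\<lambda>i. g (\<lambda>j. if j = i then 1 else 0)"] g_nonneg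
    by (metis (no_types, lifting) finite_lessThan lessThan_iff order_antisym sum_nonneg)
  have "g u = 0"
  proof (rule vector_induct_delta [where n = n and P = "\<lambda>u. g u = 0"])
    show "g v = 0" if "\<And>i. i < n \<Longrightarrow> u i = v i" "g u = 0" for u v
      using that contract1_cong [of n u v X] vec_norm_cong [of n u v] by (simp add: g_def)
    show "g (\<lambda>_. 0) = 0"
      using scale [of 0 "\<lambda>_. 0"] by simp
    show "g (\<lambda>i. u i + v i) = 0" if "g u = 0" "g v = 0" for u v
      using parallelogram [of u v] that g_nonneg [of "\<lambda>i. u i + v i"]
        g_nonneg [of "\<lambda>i. u i - v i"] by linarith
    show "g (\<lambda>j. c * (if j = i then 1 else 0)) = 0" if "i < n" for i c
      using scale [of c "\<lambda>j. if j = i then 1 else 0"] g_delta [OF that] by simp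
  qed
  then show ?thesis by (simp add: g_def)
qed

text \<open>
  Contracting with a unit vector keeps the spectral bound and, by the previous lemma, turns an extremal
  Frobenius norm into the extremal Frobenius norm of the smaller format. At order one the two bounds leave
  only Frobenius norm one.
\<close>

lemma unitary_tensor_if_extremal:
  fixes X :: "nat list \<Rightarrow> 'k::conj_field"
  assumes "ns \<noteq> []" "spectral_le ns X 1" "real (prod_list (butlast ns)) \<le> (frob_norm ns X)\<^sup>2"
  shows "unitary_tensor ns X"
  using assms
proof (induction ns X rule: unitary_tensor.induct)
  case (2 n X)
  then have "frob_norm [n] X \<le> 1" "1 \<le> frob_norm [n] X"
    using frob_norm_le_spectral_le_vector [of n X 1] power2_le_imp_le [of 1 "frob_norm [n] X"]
    by auto
  then show ?case by simp
next
  case (3 n m ns X)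
  let ?p = "real (prod_list (butlast (m # ns)))"
  have le: "(frob_norm (m # ns) (contract1 n X u))\<^sup>2 \<le> ?p * (vec_norm n u)\<^sup>2" for u :: "nat \<Rightarrow> 'k"
    using frob_norm_sq_le_spectral_le [OF _ spectral_le_contract1 [OF "3.prems"(2), of u]] by simp
  have eq: "(frob_norm (m # ns) (contract1 n X u))\<^sup>2 = ?p * (vec_norm n u)\<^sup>2" for u :: "nat \<Rightarrow> 'k"
    using "3.prems"(3) by (intro contract1_frob_norm_extremal le) simp
  show ?case
    unfolding unitary_tensor.simps
  proof (intro allI impI)
    fix u :: "nat \<Rightarrow> 'k" assume u: "vec_norm n u = 1"
    have "spectral_le (m # ns) (contract1 n X u) 1"
      using spectral_le_contract1 [OF "3.prems"(2), of u] by (simp add: u)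
    then show "unitary_tensor (m # ns) (contract1 n X u)"
      using "3.IH" [of u] eq [of u] u by simp
  qed
qed simp

lemma unitary_tensor_spectral_le:
  fixes X :: "nat list \<Rightarrow> 'k::conj_field"
  assumes "unitary_tensor ns X" shows "spectral_le ns X 1"
  using assms
proof (induction ns X rule: unitary_tensor.induct)
  case (2 n X)
  then show ?case
    using norm_frob_inner_le [of "[n]" X]
    unfolding spectral_le_def by (metis frob_norm_elem_tensor_unit mult_1 unitary_tensor.simps(2))
next
  case (3 n m ns X)
  show ?case
    unfolding spectral_le_def
  proof (intro allI impI)
    fix u :: "nat \<Rightarrow> nat \<Rightarrow> 'k" assume u: "unit_vectors (n # m # ns) u"
    let ?v = "\<lambda>i. conjg (u 0 i)" and ?w = "\<lambda>\<mu>. u (Suc \<mu>)"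
    have "vec_norm n ?v = 1" "unit_vectors (m # ns) ?w"
      using u by (force simp: unit_vectors_def vec_norm_def)+
    moreover have "case_nat (\<lambda>i. conjg (?v i)) ?w = u"
      by (auto simp: fun_eq_iff split: nat.split)
    ultimately show "norm (frob_inner (n # m # ns) X (elem_tensor (n # m # ns) u)) \<le> 1"
      using 3 frob_inner_Cons_elem_tensor [of n "m # ns" X ?v ?w] by (auto simp: spectral_le_def)
  qed
qed simp

lemma unitary_tensor_frob_norm_sq:
  fixes X :: "nat list \<Rightarrow> 'k::conj_field"
  assumes "unitary_tensor ns X"
  shows "(frob_norm ns X)\<^sup>2 = real (prod_list (butlast ns))"
  using assms
proof (induction ns X rule: unitary_tensor.induct)
  case (3 n m ns X)
  have "(frob_norm (m # ns) (\<lambda>is. X (i # is)))\<^sup>2 = real (prod_list (butlast (m # ns)))"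
    if i: "i < n" for i
  proof -
    have "unitary_tensor (m # ns) (contract1 n X (\<lambda>j. if j = i then 1 else 0))"
      using "3.prems" vec_norm_delta [OF i] unfolding unitary_tensor.simps by blast
    then show ?thesis
      using "3.IH" [OF vec_norm_delta [OF i]] unfolding contract1_delta [OF i] by blast
  qed
  then show ?case
    by (simp add: frob_norm_sq_Cons)
qed auto

section \<open>The nuclear norm\<close>

text \<open>
  The set whose infimum is the nuclear norm. Operations on decompositions are operations on this set, so that
  estimates of the infimum are needed only at the end.
\<close>

definition nuclear_costs :: "nat list \<Rightarrow> (nat list \<Rightarrow> 'k::conj_field) \<Rightarrow> real set"
  where "nuclear_costs ns X = {(\<Sum>k<m. frob_norm ns (Z k)) | (m::nat) Z.
    (\<forall>k<m. Z k \<in> elem_tensors ns) \<and> X = (\<lambda>is. \<Sum>k<m. Z k is)}"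

lemma nuclear_norm_eq_Inf: "nuclear_norm ns X = Inf (nuclear_costs ns X)"
  by (simp add: nuclear_norm_def nuclear_costs_def)

lemma nuclear_costsI:
  fixes m :: nat
  assumes "\<And>k. k < m \<Longrightarrow> Z k \<in> elem_tensors ns"
    and "X = (\<lambda>is. \<Sum>k<m. Z k is)" and "c = (\<Sum>k<m. frob_norm ns (Z k))"
  shows "c \<in> nuclear_costs ns X"
  unfolding nuclear_costs_def mem_Collect_eq
  by (intro exI [of _ m] exI [of _ Z]) (simp add: assms)

lemma nuclear_costsE:
  assumes "c \<in> nuclear_costs ns X"
  obtains m :: nat and Z where "\<And>k. k < m \<Longrightarrow> Z k \<in> elem_tensors ns"
    and "X = (\<lambda>is. \<Sum>k<m. Z k is)" and "c = (\<Sum>k<m. frob_norm ns (Z k))"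
  using assms unfolding nuclear_costs_def by blast

lemma nuclear_costs_nonneg: "c \<in> nuclear_costs ns X \<Longrightarrow> 0 \<le> c"
  by (elim nuclear_costsE) (simp add: sum_nonneg)

lemma nuclear_norm_le: "c \<in> nuclear_costs ns X \<Longrightarrow> nuclear_norm ns X \<le> c"
  unfolding nuclear_norm_eq_Inf
  by (rule cInf_lower) (auto intro: bdd_belowI nuclear_costs_nonneg)

lemma zero_nuclear_costs: "0 \<in> nuclear_costs ns (\<lambda>_. 0)"
  by (rule nuclear_costsI [of 0]) auto

lemma elem_tensor_nuclear_costs: "Z \<in> elem_tensors ns \<Longrightarrow> frob_norm ns Z \<in> nuclear_costs ns Z"
  by (rule nuclear_costsI [of "Suc 0" "\<lambda>_. Z"]) auto

lemma add_nuclear_costs: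
  assumes "a \<in> nuclear_costs ns X" "b \<in> nuclear_costs ns Y"
  shows "a + b \<in> nuclear_costs ns (\<lambda>is. X is + Y is)"
proof -
  obtain m :: nat and Z where Z: "\<And>k. k < m \<Longrightarrow> Z k \<in> elem_tensors ns"
    "X = (\<lambda>is. \<Sum>k<m. Z k is)" "a = (\<Sum>k<m. frob_norm ns (Z k))"
    using assms(1) by (rule nuclear_costsE) blast
  obtain l :: nat and W where W: "\<And>k. k < l \<Longrightarrow> W k \<in> elem_tensors ns"
    "Y = (\<lambda>is. \<Sum>k<l. W k is)" "b = (\<Sum>k<l. frob_norm ns (W k))"
    using assms(2) by (rule nuclear_costsE) blast
  define V where "V = (\<lambda>k. if k < m then Z k else W (k - m))"
  have concat: "(\<Sum>k<m + l. f (V k)) = (\<Sum>k<m. f (Z k)) + (\<Sum>k<l. f (W k))"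
    for f :: "_ \<Rightarrow> 'c::comm_monoid_add"
    by (induction l) (auto simp: V_def add.assoc)
  show ?thesis
  proof (rule nuclear_costsI [of "m + l" V])
    show "V k \<in> elem_tensors ns" if "k < m + l" for k
      using that Z(1) W(1) by (auto simp: V_def)
    show "(\<lambda>is. X is + Y is) = (\<lambda>is. \<Sum>k<m + l. V k is)"
      using concat [of "\<lambda>T. T _"] by (simp add: Z(2) W(2))
    show "a + b = (\<Sum>k<m + l. frob_norm ns (V k))"
      using concat [of "frob_norm ns"] by (simp add: Z(3) W(3))
  qed
qed

lemma sum_nuclear_costs:
  assumes "\<And>i. i < (n::nat) \<Longrightarrow> c i \<in> nuclear_costs ns (X i)"
  shows "(\<Sum>i<n. c i) \<in> nuclear_costs ns (\<lambda>is. \<Sum>i<n. X i is)"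
  using assms by (induction n) (auto intro: add_nuclear_costs zero_nuclear_costs)

lemma nuclear_costs_map:
  assumes c: "c \<in> nuclear_costs ns X"
    and elem: "\<And>Z. Z \<in> elem_tensors ns \<Longrightarrow> T Z \<in> elem_tensors ms"
    and norm: "\<And>Z. Z \<in> elem_tensors ns \<Longrightarrow> frob_norm ms (T Z) = r * frob_norm ns Z"
    and sum: "\<And>m Z. T (\<lambda>is. \<Sum>k<(m::nat). Z k is) = (\<lambda>is. \<Sum>k<m. T (Z k) is)"
  shows "r * c \<in> nuclear_costs ms (T X)"
proof -
  obtain m :: nat and Z where Z: "\<And>k. k < m \<Longrightarrow> Z k \<in> elem_tensors ns"
    "X = (\<lambda>is. \<Sum>k<m. Z k is)" "c = (\<Sum>k<m. frob_norm ns (Z k))"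
    using c by (rule nuclear_costsE) blast
  show ?thesis
    by (rule nuclear_costsI [of m "\<lambda>k. T (Z k)"]) (auto simp: Z elem norm sum sum_distrib_left)
qed

lemma cmult_nuclear_costs:
  assumes "c \<in> nuclear_costs ns X" "ns \<noteq> []"
  shows "norm a * c \<in> nuclear_costs ns (\<lambda>is. a * X is)"
  using assms(1)
  by (rule nuclear_costs_map)
    (simp_all add: cmult_elem_tensors assms(2) frob_norm_cmult sum_distrib_left)

text \<open>The tensor \<open>e\<^sub>i \<otimes> X\<close>, for the standard basis vector \<open>e\<^sub>i\<close>.\<close>

definition delta_tensor :: "nat \<Rightarrow> (nat list \<Rightarrow> 'k::conj_field) \<Rightarrow> nat list \<Rightarrow> 'k"
  where "delta_tensor i X = (\<lambda>is. if is \<noteq> [] \<and> hd is = i then X (tl is) else 0)"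

lemma delta_tensor_Cons [simp]: "delta_tensor i X (j # is) = (if j = i then X is else 0)"
  by (simp add: delta_tensor_def)

lemma delta_tensor_elem_tensor:
  assumes "i < n"
  shows "delta_tensor i (elem_tensor ns u)
    = elem_tensor (n # ns) (case_nat (\<lambda>j. if j = i then 1 else 0) u)" (is "?L = ?R")
proof
  show "?L is = ?R is" for "is"
  proof (cases "is")
    case Nil
    then show ?thesis by (simp add: delta_tensor_def elem_tensor_def indices_def)
  next
    case (Cons j js)
    then show ?thesis using assms by (simp add: elem_tensor_Cons)
  qed
qed

lemma delta_tensor_nuclear_costs:
  assumes "c \<in> nuclear_costs ns X" "i < n"
  shows "c \<in> nuclear_costs (n # ns) (delta_tensor i X)"
proof -
  have "1 * c \<in> nuclear_costs (n # ns) (delta_tensor i X)"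
    using assms(1)
  proof (rule nuclear_costs_map)
    fix Z :: "nat list \<Rightarrow> 'a" assume "Z \<in> elem_tensors ns"
    then show "delta_tensor i Z \<in> elem_tensors (n # ns)"
      by (auto simp: elem_tensors_def delta_tensor_elem_tensor [OF assms(2)])
    have "(frob_norm (n # ns) (delta_tensor i Z))\<^sup>2 = (frob_norm ns Z)\<^sup>2"
      using assms(2) by (simp add: frob_norm_sq sum_indices_Cons sum.delta
          if_distrib [of "\<lambda>x. (norm x)\<^sup>2"] if_distrib [of "sum _"] cong: if_cong)
        (subst sum.swap, simp)
    then show "frob_norm (n # ns) (delta_tensor i Z) = 1 * frob_norm ns Z"
      by simp
  next
    fix m :: nat and Z :: "nat \<Rightarrow> nat list \<Rightarrow> 'a"
    show "delta_tensor i (\<lambda>is. \<Sum>k<m. Z k is) = (\<lambda>is. \<Sum>k<m. delta_tensor i (Z k) is)"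
      by (simp add: delta_tensor_def fun_eq_iff)
  qed
  then show ?thesis by simp
qed

lemma slice_in_tensors: "X \<in> tensors (n # ns) \<Longrightarrow> i < n \<Longrightarrow> (\<lambda>is. X (i # is)) \<in> tensors ns"
  by (auto simp: tensors_def)

lemma tensor_eq_sum_delta_tensor:
  assumes "X \<in> tensors (n # ns)"
  shows "X = (\<lambda>is. \<Sum>i<n. delta_tensor i (\<lambda>is. X (i # is)) is)" (is "X = ?R")
proof
  show "X is = ?R is" for "is"
  proof (cases "is")
    case Nil
    then show ?thesis using assms by (simp add: delta_tensor_def tensors_def indices_def)
  next
    case (Cons j js)
    then show ?thesis using assms by (auto simp: tensors_def)
  qed
qed

text \<open>
  The decomposition \<open>X = \<Sum>\<^sub>i e\<^sub>i \<otimes> X\<^sub>i\<close> into slices, applied recursively down to vectors, writes \<open>X\<close> as a sum of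
  elementary tensors. By the Cauchy--Schwarz inequality each direction but the last costs a factor \<open>\<surd>n\<close>.
\<close>

lemma nuclear_cost_le_frob_norm:
  assumes "ns \<noteq> []" "X \<in> tensors ns"
  shows "\<exists>c\<in>nuclear_costs ns X. c \<le> sqrt (real (prod_list (butlast ns))) * frob_norm ns X"
  using assms
proof (induction ns arbitrary: X)
  case (Cons n ns)
  show ?case
  proof (cases "ns = []")
    case True
    have "X \<in> elem_tensors [n]"
      using vector_elem_tensor [of X n] Cons.prems True by (auto simp: elem_tensors_def)
    then show ?thesis
      using elem_tensor_nuclear_costs [of X "[n]"] True by auto
  next
    case False
    define p where "p = sqrt (real (prod_list (butlast ns)))"
    let ?f = "\<lambda>i. frob_norm ns (\<lambda>is. X (i # is))"
    have "\<exists>c\<in>nuclear_costs ns (\<lambda>is. X (i # is)). c \<le> p * ?f i" if "i < n" for i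
      unfolding p_def using that Cons.prems False by (intro Cons.IH slice_in_tensors)
    then obtain c where c: "\<And>i. i < n \<Longrightarrow> c i \<in> nuclear_costs ns (\<lambda>is. X (i # is))"
      "\<And>i. i < n \<Longrightarrow> c i \<le> p * ?f i"
      by metis
    have "(\<Sum>i<n. c i) \<in> nuclear_costs (n # ns) X"
      by (subst tensor_eq_sum_delta_tensor [OF Cons.prems(2)])
        (intro sum_nuclear_costs delta_tensor_nuclear_costs c; simp)
    moreover have "(\<Sum>i<n. c i) \<le> sqrt (real (prod_list (butlast (n # ns)))) * frob_norm (n # ns) X"
    proof -
      have "(\<Sum>i<n. c i) \<le> p * (\<Sum>i<n. ?f i)"
        unfolding sum_distrib_left using c(2) by (intro sum_mono) simp
      also have "(\<Sum>i<n. ?f i) \<le> sqrt (real n * (frob_norm (n # ns) X)\<^sup>2)"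
        unfolding frob_norm_sq_Cons
        using sum_squared_le_sum_of_squares [of ?f "{..<n}"] by (intro real_le_rsqrt) (simp add: mult.commute)
      also have "p * \<dots> = sqrt (real (prod_list (butlast (n # ns)))) * frob_norm (n # ns) X"
        using False by (simp add: p_def real_sqrt_mult)
      finally show ?thesis
        by (simp add: p_def mult_left_mono)
    qed
    ultimately show ?thesis by blast
  qed
qed simp

lemma nuclear_costs_nonempty: "ns \<noteq> [] \<Longrightarrow> X \<in> tensors ns \<Longrightarrow> nuclear_costs ns X \<noteq> {}"
  using nuclear_cost_le_frob_norm [of ns X] by auto

lemma nuclear_norm_le_frob_norm:
  assumes "ns \<noteq> []" "X \<in> tensors ns"
  shows "nuclear_norm ns X \<le> sqrt (real (prod_list (butlast ns))) * frob_norm ns X"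
  using nuclear_cost_le_frob_norm [OF assms] nuclear_norm_le [of _ ns X] by (blast intro: order_trans)

lemma nuclear_norm_triangle:
  assumes "ns \<noteq> []" "X \<in> tensors ns" "Y \<in> tensors ns"
  shows "nuclear_norm ns (\<lambda>is. X is + Y is) \<le> nuclear_norm ns X + nuclear_norm ns Y"
proof (rule field_le_epsilon)
  fix e :: real assume "0 < e"
  have "\<exists>a\<in>nuclear_costs ns W. a < nuclear_norm ns W + e / 2" if "W \<in> tensors ns" for W
    using cInf_lessD [OF nuclear_costs_nonempty [OF assms(1) that], of "nuclear_norm ns W + e / 2"] \<open>0 < e\<close>
    by (auto simp: nuclear_norm_eq_Inf)
  then obtain a b where ab: "a \<in> nuclear_costs ns X" "a < nuclear_norm ns X + e / 2"
    "b \<in> nuclear_costs ns Y" "b < nuclear_norm ns Y + e / 2"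
    using assms by meson
  show "nuclear_norm ns (\<lambda>is. X is + Y is) \<le> nuclear_norm ns X + nuclear_norm ns Y + e"
    using nuclear_norm_le [OF add_nuclear_costs [OF ab(1,3)]] ab(2,4) by linarith
qed

lemma nuclear_norm_cmult_le:
  assumes "ns \<noteq> []" "X \<in> tensors ns"
  shows "nuclear_norm ns (\<lambda>is. a * X is) \<le> norm a * nuclear_norm ns X"
proof (cases "a = 0")
  case True
  then show ?thesis using nuclear_norm_le [OF zero_nuclear_costs] by simp
next
  case False
  have "nuclear_norm ns (\<lambda>is. a * X is) / norm a \<le> c" if "c \<in> nuclear_costs ns X" for c
    using nuclear_norm_le [OF cmult_nuclear_costs [OF that assms(1), of a]] False by (simp add: field_simps)
  then have "nuclear_norm ns (\<lambda>is. a * X is) / norm a \<le> nuclear_norm ns X"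
    unfolding nuclear_norm_eq_Inf [of ns X] by (intro cInf_greatest nuclear_costs_nonempty assms)
  then show ?thesis using False by (simp add: field_simps)
qed

lemma cmult_in_tensors: "X \<in> tensors ns \<Longrightarrow> (\<lambda>is. c * X is) \<in> tensors ns"
  by (simp add: tensors_def)

lemma diff_in_tensors: "X \<in> tensors ns \<Longrightarrow> Y \<in> tensors ns \<Longrightarrow> (\<lambda>is. X is - Y is) \<in> tensors ns"
  by (simp add: tensors_def)

lemma nuclear_norm_cmult:
  assumes "ns \<noteq> []" "X \<in> tensors ns" "a \<noteq> 0"
  shows "nuclear_norm ns (\<lambda>is. a * X is) = norm a * nuclear_norm ns X"
proof (rule antisym)
  have "nuclear_norm ns X \<le> norm (inverse a) * nuclear_norm ns (\<lambda>is. a * X is)"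
    using nuclear_norm_cmult_le [OF assms(1) cmult_in_tensors [OF assms(2)], of "inverse a" a] assms(3)
    by (simp flip: mult.assoc)
  then show "norm a * nuclear_norm ns X \<le> nuclear_norm ns (\<lambda>is. a * X is)"
    using assms(3) by (simp add: norm_inverse pos_le_divide_eq mult.commute
        flip: divide_inverse_commute)
qed (rule nuclear_norm_cmult_le [OF assms(1,2)])

text \<open>The easy half of the duality between the spectral and the nuclear norm.\<close>

lemma frob_inner_le_nuclear_norm:
  assumes "ns \<noteq> []" "Y \<in> tensors ns" "spectral_le ns X 1"
  shows "norm (frob_inner ns X Y) \<le> nuclear_norm ns Y"
  unfolding nuclear_norm_eq_Inf
proof (rule cInf_greatest [OF nuclear_costs_nonempty [OF assms(1,2)]])
  fix c assume "c \<in> nuclear_costs ns Y"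
  then obtain m :: nat and Z where Z: "\<And>k. k < m \<Longrightarrow> Z k \<in> elem_tensors ns"
    "Y = (\<lambda>is. \<Sum>k<m. Z k is)" "c = (\<Sum>k<m. frob_norm ns (Z k))"
    by (rule nuclear_costsE) blast
  have "norm (frob_inner ns X Y) \<le> (\<Sum>k<m. norm (frob_inner ns X (Z k)))"
    unfolding Z(2) frob_inner_sum_right by (rule norm_sum)
  also have "\<dots> \<le> c"
    unfolding Z(3) using spectral_leD [OF assms(3) Z(1)] by (intro sum_mono) simp
  finally show "norm (frob_inner ns X Y) \<le> c" .
qed

text \<open>
  The nuclear norm can be as large as \<open>M\<close> only if no elementary tensor is a good approximation of \<open>X\<close>. This
  stands in for the other half of the duality, for which one would separate convex sets. Let \<open>E\<close> be elementary
  with unit factors and phase such that \<open>\<langle>X, E\<rangle> = \<sigma> \<ge> 0\<close>. Removing \<open>s E\<close> costs \<open>s\<close> and leaves a remainder of Frobenius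
  norm at most \<open>1 - s \<sigma> + s\<^sup>2 / 2\<close>, and therefore \<open>M = \<parallel>X\<parallel>\<^sub>* \<le> s + M (1 - s \<sigma> + s\<^sup>2 / 2)\<close>. Cancelling \<open>M\<close>, dividing by \<open>s\<close>
  and letting \<open>s\<close> tend to \<open>0\<close> gives \<open>M \<sigma> \<le> 1\<close>.
\<close>

lemma spectral_le_if_nuclear_norm_extremal:
  fixes X :: "nat list \<Rightarrow> 'k::conj_field"
  assumes ns: "ns \<noteq> []" and X: "X \<in> tensors ns" "frob_norm ns X = 1" and M: "0 < M"
    and bound: "\<And>Y::nat list \<Rightarrow> 'k. Y \<in> tensors ns \<Longrightarrow> nuclear_norm ns Y \<le> M * frob_norm ns Y"
    and eq: "nuclear_norm ns X = M"
  shows "spectral_le ns X (1 / M)"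
  unfolding spectral_le_def
proof (intro allI impI)
  fix u :: "nat \<Rightarrow> nat \<Rightarrow> 'k" assume u: "unit_vectors ns u"
  let ?E = "elem_tensor ns u"
  define \<sigma> where "\<sigma> = frob_inner ns X ?E"
  show "norm \<sigma> \<le> 1 / M"
  proof (cases "\<sigma> = 0")
    case True
    then show ?thesis using M by simp
  next
    case False
    \<comment> \<open>the phase that makes the inner product with \<open>X\<close> real and positive\<close>
    define c where "c = conjg \<sigma> / of_real (norm \<sigma>)"
    have c: "norm c = 1" "c * \<sigma> = of_real (norm \<sigma>)"
      using False conjg_mult_self [of \<sigma>]
      by (simp_all add: c_def norm_divide scaleR_conv_of_real power2_eq_square)
    have step: "M * norm \<sigma> \<le> 1 + t" if t: "0 < t" for t
    proof -
      \<comment> \<open>the step size for which the quadratic error \<open>M s / 2\<close> equals \<open>t\<close>\<close>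
      define s where "s = 2 * t / M"
      have s: "0 < s" "M * s = 2 * t" using t M by (auto simp: s_def)
      let ?Z = "\<lambda>is. of_real s * c * ?E is"
      let ?Y = "\<lambda>is. X is - ?Z is"
      have Z: "?Z \<in> elem_tensors ns" "frob_norm ns ?Z = s"
        using u c(1) s cmult_elem_tensors [OF _ ns, of ?E]
        by (simp_all add: frob_norm_cmult norm_mult frob_norm_elem_tensor_unit elem_tensors_def)
      then have Zt: "?Z \<in> tensors ns"
        by (auto simp: elem_tensors_def elem_tensor_in_tensors)
      have inner: "frob_inner ns X ?Z = of_real (s * norm \<sigma>)"
        unfolding frob_inner_cmult_right using c(2) by (simp add: \<sigma>_def mult.assoc)
      have "frob_norm ns ?Y \<le> 1 - s * norm \<sigma> + s\<^sup>2 / 2"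
      proof -
        have "(frob_norm ns ?Y)\<^sup>2 = 1 - 2 * (s * norm \<sigma>) + s\<^sup>2"
          using frob_norm_diff_sq [OF inner] X(2) Z(2) by simp
        moreover have "2 * frob_norm ns ?Y \<le> 1 + (frob_norm ns ?Y)\<^sup>2"
          using sum_squares_bound [of 1 "frob_norm ns ?Y"] by simp
        ultimately show ?thesis by simp
      qed
      then have Y: "M * frob_norm ns ?Y \<le> M * (1 - s * norm \<sigma> + s\<^sup>2 / 2)"
        using M by simp
      have "M = nuclear_norm ns (\<lambda>is. ?Z is + ?Y is)"
        using eq by simp
      also have "\<dots> \<le> s + M * (1 - s * norm \<sigma> + s\<^sup>2 / 2)"
        using nuclear_norm_triangle [OF ns Zt diff_in_tensors [OF X(1) Zt]]
          nuclear_norm_le [OF elem_tensor_nuclear_costs [OF Z(1)]] Z(2)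
          bound [OF diff_in_tensors [OF X(1) Zt]] Y by linarith
      finally have "s * (M * norm \<sigma>) \<le> s * (1 + M * s / 2)"
        by (simp add: algebra_simps power2_eq_square)
      then show ?thesis using s by simp
    qed
    have "M * norm \<sigma> \<le> 1"
      by (rule field_le_epsilon) (rule step)
    then show ?thesis using M by (simp add: field_simps)
  qed
qed

section \<open>Compactness and attainment\<close>

definition unit_sphere :: "nat list \<Rightarrow> (nat list \<Rightarrow> 'k::conj_field) set"
  where "unit_sphere ns = {X \<in> tensors ns. frob_norm ns X = 1}"

lemma compact_PiE_UNIV:
  fixes S :: "'a \<Rightarrow> 'b::topological_space set"
  assumes "\<And>i. compact (S i)"
  shows "compact (PiE UNIV S)"
  using assms compactin_PiE [of "\<lambda>_. euclidean" UNIV S]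
  by (simp add: euclidean_product_topology)

lemma continuous_on_L2_set:
  assumes "\<And>i. i \<in> I \<Longrightarrow> continuous_on S (f i)"
  shows "continuous_on S (\<lambda>x. L2_set (\<lambda>i. f i x) I)"
  unfolding L2_set_def by (intro continuous_intros assms)

text \<open>
  The space of all functions on multi-indices carries the product topology. A tensor of Frobenius norm one
  has its entries in the unit ball, and in the ball of radius \<open>0\<close> outside the format, so that Tychonoff's theorem
  applies.
\<close>

lemma compact_unit_sphere: "compact (unit_sphere ns :: (nat list \<Rightarrow> 'k::{conj_field,heine_borel}) set)"
proof -
  let ?B = "\<lambda>is. cball (0::'k) (if is \<in> indices ns then 1 else 0)"
  let ?N = "\<lambda>X::nat list \<Rightarrow> 'k. frob_norm ns X"
  have "continuous_on UNIV ?N"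
    unfolding frob_norm_def
    by (intro continuous_on_L2_set continuous_intros continuous_on_product_coordinates)
  then have "closed (?N -` {1})"
    by (intro continuous_closed_vimage) (auto simp: continuous_on_eq_continuous_at)
  then have "compact (PiE UNIV ?B \<inter> ?N -` {1})"
    by (intro compact_Int_closed compact_PiE_UNIV compact_cball)
  moreover have entry: "norm (X is) \<le> frob_norm ns X" if "is \<in> indices ns"
    for X :: "nat list \<Rightarrow> 'k" and "is"
    unfolding frob_norm_def by (rule member_le_L2_set) (use that in auto)
  have "unit_sphere ns = PiE UNIV ?B \<inter> ?N -` {1}"
  proof (intro set_eqI iffI)
    fix X :: "nat list \<Rightarrow> 'k" assume "X \<in> unit_sphere ns"
    then have "?N X = 1" "X is \<in> ?B is" for "is"
      using entry [of "is" X] by (auto simp: unit_sphere_def tensors_def)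
    then show "X \<in> PiE UNIV ?B \<inter> ?N -` {1}"
      by (simp add: PiE_UNIV_domain)
  next
    fix X :: "nat list \<Rightarrow> 'k" assume X: "X \<in> PiE UNIV ?B \<inter> ?N -` {1}"
    then have "X is \<in> ?B is" for "is"
      by (intro PiE_mem [of X UNIV ?B]) auto
    then have "X is = 0" if "is \<notin> indices ns" for "is"
      using that by (metis cball_trivial singletonD)
    then show "X \<in> unit_sphere ns"
      using X by (simp add: unit_sphere_def tensors_def)
  qed
  ultimately show ?thesis by simp
qed

lemma unit_sphere_nonempty:
  assumes "0 \<notin> set ns" shows "(unit_sphere ns :: (nat list \<Rightarrow> 'k::conj_field) set) \<noteq> {}"
proof -
  obtain js where js: "js \<in> indices ns"
    using indices_nonempty [OF assms] by blast
  define X :: "nat list \<Rightarrow> 'k" where "X = (\<lambda>is. if is = js then 1 else 0)"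
  have "(frob_norm ns X)\<^sup>2 = 1"
    using js by (simp add: X_def frob_norm_sq if_distrib [of "\<lambda>x. (norm x)\<^sup>2"] cong: if_cong)
  then have "frob_norm ns X = 1"
    using frob_norm_nonneg [of ns X] power2_eq_1_iff [of "frob_norm ns X"] by linarith
  then have "X \<in> unit_sphere ns"
    using js by (auto simp: unit_sphere_def tensors_def X_def)
  then show ?thesis by blast
qed

text \<open>
  The function space is not a normed space, so a Lipschitz bound in the Frobenius norm has to be turned into
  continuity for the product topology. The Frobenius norm depends on finitely many entries and is continuous.
\<close>

lemma continuous_on_frob_Lipschitz:
  fixes f :: "(nat list \<Rightarrow> 'k::conj_field) \<Rightarrow> real"
  assumes lip: "\<And>X Y. X \<in> S \<Longrightarrow> Y \<in> S \<Longrightarrow> f X \<le> f Y + C * frob_norm ns (\<lambda>is. X is - Y is)"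
  shows "continuous_on S f"
  unfolding continuous_on_def
proof
  fix X assume X: "X \<in> S"
  have "continuous_on UNIV (\<lambda>Y. C * frob_norm ns (\<lambda>is. Y is - X is))"
    unfolding frob_norm_def
    by (intro continuous_on_L2_set continuous_intros continuous_on_product_coordinates)
  then have "((\<lambda>Y. C * frob_norm ns (\<lambda>is. Y is - X is)) \<longlongrightarrow> C * frob_norm ns (\<lambda>is. X is - X is)) (at X within S)"
    using X continuous_on_subset [of UNIV _ S] unfolding continuous_on_def by blast
  then have "((\<lambda>Y. C * frob_norm ns (\<lambda>is. Y is - X is)) \<longlongrightarrow> 0) (at X within S)"
    by (simp add: frob_norm_def L2_set_def)
  moreover have "\<forall>\<^sub>F Y in at X within S. norm (f Y - f X) \<le> C * frob_norm ns (\<lambda>is. Y is - X is)"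
    unfolding eventually_at_topological
  proof (intro exI [of _ UNIV] conjI ballI impI)
    fix Y assume "Y \<in> S"
    moreover have "frob_norm ns (\<lambda>is. X is - Y is) = frob_norm ns (\<lambda>is. Y is - X is)"
      by (simp add: frob_norm_def norm_minus_commute)
    ultimately show "norm (f Y - f X) \<le> C * frob_norm ns (\<lambda>is. Y is - X is)"
      using lip [OF X, of Y] lip [of Y, OF _ X] by (simp add: abs_le_iff)
  qed auto
  ultimately have "((\<lambda>Y. f Y - f X) \<longlongrightarrow> 0) (at X within S)"
    by (rule Lim_null_comparison [rotated])
  then show "(f \<longlongrightarrow> f X) (at X within S)"
    by (simp add: LIM_zero_iff)
qed

lemma spectral_norm_attained:
  fixes X :: "nat list \<Rightarrow> 'k::{conj_field,heine_borel}"
  assumes "0 \<notin> set ns"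
  obtains u where "unit_vectors ns u" "spectral_norm ns X = norm (frob_inner ns X (elem_tensor ns u))"
    and "spectral_le ns X (spectral_norm ns X)"
proof -
  let ?d = "length ns"
  let ?f = "\<lambda>u. norm (frob_inner ns X (elem_tensor ns u))"
  \<comment> \<open>The entries without influence must be bounded too, to make the domain compact; truncation sets them to \<open>0\<close>.\<close>
  let ?B = "PiE UNIV (\<lambda>_. PiE UNIV (\<lambda>_. cball 0 1)) :: (nat \<Rightarrow> nat \<Rightarrow> 'k) set"
  define U where "U = ?B \<inter> (\<Inter>\<mu><?d. (\<lambda>u. vec_norm (ns ! \<mu>) (u \<mu>)) -` {1})"
  have coord: "continuous_on T (\<lambda>u. u \<mu> i)" for \<mu> i and T :: "(nat \<Rightarrow> nat \<Rightarrow> 'k) set"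
    by (rule continuous_on_product_then_coordinatewise [of T "\<lambda>u. u \<mu>"])
      (rule continuous_on_product_then_coordinatewise, rule continuous_on_id)
  have "continuous_on UNIV (\<lambda>u::nat \<Rightarrow> nat \<Rightarrow> 'k. vec_norm n (u \<mu>))" for n \<mu>
    unfolding vec_norm_def by (intro continuous_on_L2_set continuous_on_norm coord)
  then have "closed ((\<lambda>u::nat \<Rightarrow> nat \<Rightarrow> 'k. vec_norm n (u \<mu>)) -` {1})" for n \<mu>
    by (intro continuous_closed_vimage) (auto simp: continuous_on_eq_continuous_at)
  then have "compact U"
    unfolding U_def by (intro compact_Int_closed closed_INT compact_PiE_UNIV compact_cball ballI)
  have U: "unit_vectors ns u" if "u \<in> U" for u
    using that by (auto simp: U_def unit_vectors_def)
  have truncate: "\<exists>v\<in>U. elem_tensor ns v = elem_tensor ns u" if u: "unit_vectors ns u" for u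
  proof
    let ?v = "\<lambda>\<mu> i. if \<mu> < ?d \<and> i < ns ! \<mu> then u \<mu> i else 0"
    have v: "vec_norm (ns ! \<mu>) (?v \<mu>) = 1" if "\<mu> < ?d" for \<mu>
      using u that vec_norm_cong [of "ns ! \<mu>" "?v \<mu>" "u \<mu>"] by (simp add: unit_vectors_def)
    have "norm (?v \<mu> i) \<le> 1" for \<mu> i
    proof (cases "\<mu> < ?d \<and> i < ns ! \<mu>")
      case True
      then have "norm (?v \<mu> i) \<le> vec_norm (ns ! \<mu>) (?v \<mu>)"
        unfolding vec_norm_def by (intro member_le_L2_set) auto
      then show ?thesis using v True by simp
    qed auto
    then show "?v \<in> U"
      using v by (auto simp: U_def PiE_UNIV_domain)
    show "elem_tensor ns ?v = elem_tensor ns u"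
      by (auto simp: elem_tensor_def indices_def list_all2_conv_all_nth fun_eq_iff intro!: prod.cong)
  qed
  have "unit_vectors ns (\<lambda>_ j. if j = 0 then 1 else 0 :: 'k)"
    unfolding unit_vectors_def
    using assms by (auto intro!: vec_norm_delta simp: in_set_conv_nth)
  then have "U \<noteq> {}"
    using truncate by blast
  have "elem_tensor ns u is = (if is \<in> indices ns then \<Prod>\<mu><?d. u \<mu> (is ! \<mu>) else 0)" for u :: "nat \<Rightarrow> nat \<Rightarrow> 'k" and "is"
    by (simp add: elem_tensor_def)
  then have "continuous_on U ?f"
    unfolding frob_inner_def by (simp, intro continuous_intros coord)
  then obtain u where u: "u \<in> U" "\<And>v. v \<in> U \<Longrightarrow> ?f v \<le> ?f u"
    using continuous_attains_sup [OF \<open>compact U\<close> \<open>U \<noteq> {}\<close>] by blast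
  have max: "?f v \<le> ?f u" if "unit_vectors ns v" for v
    using truncate [OF that] u(2) by metis
  have "spectral_norm ns X = ?f u"
    unfolding spectral_norm_def
    by (rule Greatest_equality) (use U [OF u(1)] max in \<open>auto simp: unit_vectors_def\<close>)
  then show thesis
    using that [OF U [OF u(1)]] max by (simp add: spectral_le_def)
qed

lemma spectral_norm_le_iff:
  fixes X :: "nat list \<Rightarrow> 'k::{conj_field,heine_borel}"
  assumes "0 \<notin> set ns"
  shows "spectral_norm ns X \<le> s \<longleftrightarrow> spectral_le ns X s"
proof -
  obtain u where "unit_vectors ns u" "spectral_norm ns X = norm (frob_inner ns X (elem_tensor ns u))"
    "spectral_le ns X (spectral_norm ns X)"
    using spectral_norm_attained [OF assms] .
  then show ?thesis
    by (auto simp: spectral_le_def intro: order_trans)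
qed

lemma spectral_norm_nonneg:
  fixes X :: "nat list \<Rightarrow> 'k::{conj_field,heine_borel}"
  assumes "0 \<notin> set ns"
  shows "0 \<le> spectral_norm ns X"
  using spectral_norm_attained [OF assms, of X] by (metis norm_ge_zero)

lemma spectral_norm_cmult:
  fixes X :: "nat list \<Rightarrow> 'k::{conj_field,heine_borel}"
  assumes "0 \<notin> set ns" "c \<noteq> 0"
  shows "spectral_norm ns (\<lambda>is. c * X is) = norm c * spectral_norm ns X"
proof (rule antisym)
  have le: "spectral_norm ns (\<lambda>is. a * Y is) \<le> norm a * spectral_norm ns Y" for a and Y :: "nat list \<Rightarrow> 'k"
    using spectral_le_cmult [of ns Y "spectral_norm ns Y" a]
    by (simp flip: spectral_norm_le_iff [OF assms(1)])
  show "spectral_norm ns (\<lambda>is. c * X is) \<le> norm c * spectral_norm ns X"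
    by (rule le)
  show "norm c * spectral_norm ns X \<le> spectral_norm ns (\<lambda>is. c * X is)"
    using le [of "inverse c" "\<lambda>is. c * X is"] assms(2)
    by (simp add: norm_inverse pos_le_divide_eq mult.commute flip: mult.assoc divide_inverse_commute)
qed

lemma frob_norm_le_spectral_norm:
  fixes X :: "nat list \<Rightarrow> 'k::{conj_field,heine_borel}"
  assumes "ns \<noteq> []" "0 \<notin> set ns"
  shows "frob_norm ns X \<le> sqrt (real (prod_list (butlast ns))) * spectral_norm ns X"
proof -
  have "(frob_norm ns X)\<^sup>2 \<le> real (prod_list (butlast ns)) * (spectral_norm ns X)\<^sup>2"
    using assms spectral_norm_nonneg [OF assms(2), of X] spectral_norm_le_iff [OF assms(2), of X]
    by (intro frob_norm_sq_le_spectral_le) auto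
  then have "frob_norm ns X \<le> sqrt (real (prod_list (butlast ns)) * (spectral_norm ns X)\<^sup>2)"
    by (rule real_le_rsqrt)
  then show ?thesis
    using spectral_norm_nonneg [OF assms(2), of X] by (simp add: real_sqrt_mult)
qed

lemma spectral_norm_triangle:
  fixes X :: "nat list \<Rightarrow> 'k::{conj_field,heine_borel}"
  assumes "0 \<notin> set ns"
  shows "spectral_norm ns X \<le> spectral_norm ns Y + frob_norm ns (\<lambda>is. X is - Y is)"
  unfolding spectral_norm_le_iff [OF assms] spectral_le_def
proof (intro allI impI)
  fix u :: "nat \<Rightarrow> nat \<Rightarrow> 'k" assume u: "unit_vectors ns u"
  let ?E = "elem_tensor ns u"
  have "norm (frob_inner ns X ?E) \<le> norm (frob_inner ns Y ?E) + norm (frob_inner ns (\<lambda>is. X is - Y is) ?E)"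
    unfolding frob_inner_diff_left by (rule norm_triangle_sub)
  moreover have "norm (frob_inner ns Y ?E) \<le> spectral_norm ns Y"
    using u spectral_norm_le_iff [OF assms, of Y "spectral_norm ns Y"] by (simp add: spectral_le_def)
  moreover have "norm (frob_inner ns (\<lambda>is. X is - Y is) ?E) \<le> frob_norm ns (\<lambda>is. X is - Y is)"
    using norm_frob_inner_le [of ns "\<lambda>is. X is - Y is" ?E] u by (simp add: frob_norm_elem_tensor_unit)
  ultimately show "norm (frob_inner ns X ?E) \<le> spectral_norm ns Y + frob_norm ns (\<lambda>is. X is - Y is)"
    by linarith
qed

lemma normalize_in_unit_sphere:
  assumes "X \<in> tensors ns" "X \<noteq> (\<lambda>_. 0)"
  shows "(\<lambda>is. of_real (inverse (frob_norm ns X)) * X is) \<in> unit_sphere ns"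
  using frob_norm_pos [OF assms] assms(1)
  by (simp add: unit_sphere_def cmult_in_tensors frob_norm_cmult norm_inverse)

lemma unit_sphere_nonzero: "X \<in> unit_sphere ns \<Longrightarrow> X \<in> tensors ns \<and> X \<noteq> (\<lambda>_. 0) \<and> frob_norm ns X = 1"
  by (auto simp: unit_sphere_def frob_norm_def L2_set_def)

text \<open>
  Both ratios are invariant under scaling, so it suffices to optimise the norm over the compact unit sphere.
  Attainment is what makes the defining \<open>LEAST\<close> and \<open>GREATEST\<close> meaningful.
\<close>

lemma App_attained:
  assumes ns: "0 \<notin> set ns"
  obtains X :: "nat list \<Rightarrow> 'k::{conj_field,heine_borel}"
  where "X \<in> unit_sphere ns" "App TYPE('k) ns = spectral_norm ns X"
    and "\<And>Y :: nat list \<Rightarrow> 'k. Y \<in> tensors ns \<Longrightarrow> Y \<noteq> (\<lambda>_. 0) \<Longrightarrow>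
      App TYPE('k) ns \<le> spectral_norm ns Y / frob_norm ns Y"
proof -
  let ?S = "unit_sphere ns :: (nat list \<Rightarrow> 'k) set"
  have "continuous_on ?S (spectral_norm ns)"
    by (rule continuous_on_frob_Lipschitz [where C = 1 and ns = ns]) (simp add: spectral_norm_triangle [OF ns])
  then obtain X where X: "X \<in> ?S" "\<And>Y. Y \<in> ?S \<Longrightarrow> spectral_norm ns X \<le> spectral_norm ns Y"
    using continuous_attains_inf [OF compact_unit_sphere unit_sphere_nonempty [OF ns]] by metis
  have min: "spectral_norm ns X \<le> spectral_norm ns Y / frob_norm ns Y"
    if Y: "Y \<in> tensors ns" "Y \<noteq> (\<lambda>_. 0)" for Y :: "nat list \<Rightarrow> 'k"
    using X(2) [OF normalize_in_unit_sphere [OF Y]] frob_norm_pos [OF Y]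
    by (subst (asm) spectral_norm_cmult [OF ns]) (simp_all add: norm_inverse divide_inverse_commute)
  have "App TYPE('k) ns = spectral_norm ns X"
    unfolding App_def using unit_sphere_nonzero [OF X(1)] min
    by (intro Least_equality exI [of _ X]) auto
  then show thesis
    using that [of X] X(1) min by simp
qed

lemma max_nuclear_ratio_attained:
  assumes ns: "ns \<noteq> []" "0 \<notin> set ns"
  obtains X :: "nat list \<Rightarrow> 'k::{conj_field,heine_borel}"
  where "X \<in> unit_sphere ns" "max_nuclear_ratio TYPE('k) ns = nuclear_norm ns X"
    and "\<And>Y :: nat list \<Rightarrow> 'k. Y \<in> tensors ns \<Longrightarrow> Y \<noteq> (\<lambda>_. 0) \<Longrightarrow>
      nuclear_norm ns Y / frob_norm ns Y \<le> max_nuclear_ratio TYPE('k) ns"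
proof -
  let ?S = "unit_sphere ns :: (nat list \<Rightarrow> 'k) set"
  let ?M = "sqrt (real (prod_list (butlast ns)))"
  have "nuclear_norm ns X \<le> nuclear_norm ns Y + ?M * frob_norm ns (\<lambda>is. X is - Y is)"
    if "X \<in> ?S" "Y \<in> ?S" for X Y
  proof -
    have t: "Y \<in> tensors ns" "(\<lambda>is. X is - Y is) \<in> tensors ns"
      using that by (auto simp: unit_sphere_def intro: diff_in_tensors)
    show ?thesis
      using nuclear_norm_triangle [OF ns(1) t] nuclear_norm_le_frob_norm [OF ns(1) t(2)] by simp
  qed
  then have "continuous_on ?S (nuclear_norm ns)"
    by (rule continuous_on_frob_Lipschitz)
  then obtain X where X: "X \<in> ?S" "\<And>Y. Y \<in> ?S \<Longrightarrow> nuclear_norm ns Y \<le> nuclear_norm ns X"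
    using continuous_attains_sup [OF compact_unit_sphere unit_sphere_nonempty [OF ns(2)]] by metis
  have max: "nuclear_norm ns Y / frob_norm ns Y \<le> nuclear_norm ns X"
    if Y: "Y \<in> tensors ns" "Y \<noteq> (\<lambda>_. 0)" for Y :: "nat list \<Rightarrow> 'k"
    using X(2) [OF normalize_in_unit_sphere [OF Y]] frob_norm_pos [OF Y]
    by (subst (asm) nuclear_norm_cmult [OF ns(1) Y(1)]) (simp_all add: norm_inverse divide_inverse_commute)
  have "max_nuclear_ratio TYPE('k) ns = nuclear_norm ns X"
    unfolding max_nuclear_ratio_def using unit_sphere_nonzero [OF X(1)] max
    by (intro Greatest_equality exI [of _ X]) auto
  then show thesis
    using that [of X] X(1) max by simp
qed

section \<open>The extremal ratios\<close>

lemma unitary_tensor_cmult_if_extremal: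
  fixes X :: "nat list \<Rightarrow> 'k::conj_field"
  assumes ns: "ns \<noteq> []" and X: "X \<in> unit_sphere ns"
    and M: "M = sqrt (real (prod_list (butlast ns)))" "0 < M" and le: "spectral_le ns X (1 / M)"
  shows "\<exists>U :: nat list \<Rightarrow> 'k. U \<in> tensors ns \<and> unitary_tensor ns U"
proof (intro exI conjI)
  let ?U = "\<lambda>is. of_real M * X is"
  show "?U \<in> tensors ns"
    using X by (simp add: unit_sphere_def cmult_in_tensors)
  show "unitary_tensor ns ?U"
  proof (rule unitary_tensor_if_extremal [OF ns])
    show "spectral_le ns ?U 1"
      using spectral_le_cmult [OF le, of "of_real M"] M(2) by simp
    show "real (prod_list (butlast ns)) \<le> (frob_norm ns ?U)\<^sup>2"
      using X M(2) by (simp add: unit_sphere_def frob_norm_cmult) (simp add: M(1))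
  qed
qed

text \<open>
  A unitary tensor \<open>U\<close> has Frobenius norm \<open>M\<close> and spectral norm at most \<open>1\<close>. Hence its spectral ratio is at most
  \<open>1 / M\<close>, and \<open>M\<^sup>2 = \<langle>U, U\<rangle> \<le> \<parallel>U\<parallel>\<^sub>*\<close>, so that its nuclear ratio is at least \<open>M\<close>. Conversely, if a
  ratio has its extremal value, then an optimal tensor of Frobenius norm one has spectral norm at most \<open>1 / M\<close>,
  and \<open>M\<close> times it is unitary.
\<close>

theorem extremal_ratios_iff_unitary_tensor:
  assumes ns: "ns \<noteq> []" "0 \<notin> set ns" and M: "M = sqrt (real (prod_list (butlast ns)))"
  defines "ex \<equiv> \<exists>U :: nat list \<Rightarrow> 'k::{conj_field,heine_borel}. U \<in> tensors ns \<and> unitary_tensor ns U"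
  shows "App TYPE('k) ns = 1 / M \<longleftrightarrow> ex"
    and "1 / M \<le> App TYPE('k) ns"
    and "max_nuclear_ratio TYPE('k) ns = M \<longleftrightarrow> ex"
proof -
  have "prod_list (butlast ns) \<noteq> 0"
    using ns(2) by (auto simp: prod_list_zero_iff dest: in_set_butlastD)
  then have M_pos: "0 < M"
    by (simp add: M)
  obtain A :: "nat list \<Rightarrow> 'k" where A: "A \<in> unit_sphere ns" "App TYPE('k) ns = spectral_norm ns A"
    "\<And>Y :: nat list \<Rightarrow> 'k. Y \<in> tensors ns \<Longrightarrow> Y \<noteq> (\<lambda>_. 0) \<Longrightarrow>
      App TYPE('k) ns \<le> spectral_norm ns Y / frob_norm ns Y"
    using App_attained [OF ns(2)] by blast
  obtain B :: "nat list \<Rightarrow> 'k" where B: "B \<in> unit_sphere ns" "max_nuclear_ratio TYPE('k) ns = nuclear_norm ns B"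
    "\<And>Y :: nat list \<Rightarrow> 'k. Y \<in> tensors ns \<Longrightarrow> Y \<noteq> (\<lambda>_. 0) \<Longrightarrow>
      nuclear_norm ns Y / frob_norm ns Y \<le> max_nuclear_ratio TYPE('k) ns"
    using max_nuclear_ratio_attained [OF ns] by blast
  show lower: "1 / M \<le> App TYPE('k) ns"
    using frob_norm_le_spectral_norm [OF ns, of A] A M_pos
    by (simp add: unit_sphere_def M field_simps)
  have upper: "max_nuclear_ratio TYPE('k) ns \<le> M"
    using nuclear_norm_le_frob_norm [OF ns(1), of B] B by (simp add: unit_sphere_def M)
  have unitary: "App TYPE('k) ns \<le> 1 / M \<and> M \<le> max_nuclear_ratio TYPE('k) ns" if ex: ex
  proof -
    obtain U :: "nat list \<Rightarrow> 'k" where U: "U \<in> tensors ns" "unitary_tensor ns U"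
      using ex by (auto simp: ex_def)
    have le: "spectral_le ns U 1"
      using U(2) by (rule unitary_tensor_spectral_le)
    have sq: "(frob_norm ns U)\<^sup>2 = M\<^sup>2"
      using unitary_tensor_frob_norm_sq [OF U(2)] by (simp add: M)
    then have norm: "frob_norm ns U = M"
      using M_pos by simp
    then have "U \<noteq> (\<lambda>_. 0)"
      using M_pos by (auto simp: frob_norm_def L2_set_def)
    moreover have "spectral_norm ns U \<le> 1"
      using le by (simp add: spectral_norm_le_iff [OF ns(2)])
    moreover have "M\<^sup>2 \<le> nuclear_norm ns U"
      using frob_inner_le_nuclear_norm [OF ns(1) U(1) le] by (simp add: frob_inner_self sq norm_power)
    then have "M \<le> nuclear_norm ns U / frob_norm ns U"
      using M_pos by (simp add: norm field_simps power2_eq_square)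
    ultimately show ?thesis
      using A(3) [OF U(1)] B(3) [OF U(1)] M_pos
      by (fastforce simp: norm intro: order_trans divide_right_mono)
  qed
  show "App TYPE('k) ns = 1 / M \<longleftrightarrow> ex"
  proof
    assume "App TYPE('k) ns = 1 / M"
    then have "spectral_le ns A (1 / M)"
      using A(2) by (simp flip: spectral_norm_le_iff [OF ns(2)])
    then show ex
      unfolding ex_def using unitary_tensor_cmult_if_extremal [OF ns(1) A(1) M M_pos] by blast
  qed (use unitary lower in force)
  show "max_nuclear_ratio TYPE('k) ns = M \<longleftrightarrow> ex"
  proof
    assume "max_nuclear_ratio TYPE('k) ns = M"
    then have "spectral_le ns B (1 / M)"
      using B nuclear_norm_le_frob_norm [OF ns(1)] M_pos
      by (intro spectral_le_if_nuclear_norm_extremal [OF ns(1)]) (auto simp: unit_sphere_def M)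
    then show ex
      unfolding ex_def using unitary_tensor_cmult_if_extremal [OF ns(1) B(1) M M_pos] by blast
  qed (use unitary upper in force)
qed

lemma prod_list_butlast:
  "real (prod_list (butlast ns)) = (\<Prod>\<mu><length ns - 1. real (ns ! \<mu>))"
proof -
  have "prod_list (butlast ns) = (\<Prod>\<mu><length ns - 1. butlast ns ! \<mu>)"
    by (simp add: prod.list_conv_set_nth atLeast0LessThan)
  also have "\<dots> = (\<Prod>\<mu><length ns - 1. ns ! \<mu>)"
    by (intro prod.cong) (auto simp: nth_butlast)
  finally show ?thesis by simp
qed

theorem corollary3p6:
  fixes d :: nat and ns :: "nat list"
  assumes "d \<ge> 2" and "length ns = d" and "sorted ns" and "\<forall>\<mu><d. ns ! \<mu> \<ge> 1"
  shows
    "((App TYPE(real) ns = 1 / sqrt (\<Prod>\<mu><d - 1. real (ns ! \<mu>)) \<longleftrightarrow>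
         (\<exists>X :: nat list \<Rightarrow> real. X \<in> tensors ns \<and> orthogonal_tensor ns X))
      \<and> (\<not> (\<exists>X :: nat list \<Rightarrow> real. X \<in> tensors ns \<and> orthogonal_tensor ns X) \<longrightarrow>
         App TYPE(real) ns > 1 / sqrt (\<Prod>\<mu><d - 1. real (ns ! \<mu>)))
      \<and> (max_nuclear_ratio TYPE(real) ns = sqrt (\<Prod>\<mu><d - 1. real (ns ! \<mu>)) \<longleftrightarrow>
         (\<exists>X :: nat list \<Rightarrow> real. X \<in> tensors ns \<and> orthogonal_tensor ns X)))
   \<and> ((App TYPE(complex) ns = 1 / sqrt (\<Prod>\<mu><d - 1. real (ns ! \<mu>)) \<longleftrightarrow>
         (\<exists>X :: nat list \<Rightarrow> complex. X \<in> tensors ns \<and> unitary_tensor ns X))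
      \<and> (\<not> (\<exists>X :: nat list \<Rightarrow> complex. X \<in> tensors ns \<and> unitary_tensor ns X) \<longrightarrow>
         App TYPE(complex) ns > 1 / sqrt (\<Prod>\<mu><d - 1. real (ns ! \<mu>)))
      \<and> (max_nuclear_ratio TYPE(complex) ns = sqrt (\<Prod>\<mu><d - 1. real (ns ! \<mu>)) \<longleftrightarrow>
         (\<exists>X :: nat list \<Rightarrow> complex. X \<in> tensors ns \<and> unitary_tensor ns X)))"
proof -
  have ns: "ns \<noteq> []" "0 \<notin> set ns"
    using assms(1,2,4) by (force simp: in_set_conv_nth)+
  have M: "sqrt (\<Prod>\<mu><d - 1. real (ns ! \<mu>)) = sqrt (real (prod_list (butlast ns)))"
    using assms(2) by (simp only: prod_list_butlast)
  show ?thesis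
    using extremal_ratios_iff_unitary_tensor [OF ns M, where 'k = real]
      extremal_ratios_iff_unitary_tensor [OF ns M, where 'k = complex]
    by (intro conjI impI) (auto simp: order_less_le)
qed

end
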